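(* Let $\alpha=(\{X_t\}_{t\in G},\{\alpha_t\}_{t\in G})$ be a partial action of a topological group $G$ on a Hausdorff space $X$, and let $\mathrm{Gr}(\alpha)=\{(t,x,y)\in G\times X\times X:\ x\in X_{t^{-1}},\ \alpha_t(x)=y\}$ be its graph. Let $X^{e}$ be the enveloping space of $X$, i.e. the space on which the enveloping action $\alpha^{e}$ of $\alpha$ acts. Then $X^{e}$ is a Hausdorff space if and only if $\mathrm{Gr}(\alpha)$ is a closed subset of $G\times X\times X$.
   Context: A partial action of a topological group $G$ on a topological space $X$ is a pair $\alpha=(\{X_t\}_{t\in G},\{\alpha_t\}_{t\in G})$ such that: (i) each $X_t$ is open in $X$ and $\alpha_t:X_{t^{-1}}\to X_t$ is a homeomorphism; (ii) the set $\Gamma_\alpha=\{(t,x)\in G\times X: x\in X_{t^{-1}}\}$ is open in $G\times X$ and the map $\Gamma_\alpha\to X$, $(t,x)\mapsto\alpha_t(x)$, is continuous; (iii) $X_e=X$, and $\alpha_{st}$ is an extension of $\alpha_s\alpha_t$ for all $s,t\in G$. The enveloping action of $\alpha$ is the following continuous global action $\alpha^{e}$ of $G$ on a topological space $X^{e}$ (it is universal, hence unique up to isomorphism, among global actions receiving a morphism from $\alpha$): $X^{e}=(G\times X)/\!\sim$ with the quotient topology, where $(r,x)\sim(s,y)$ iff $x\in X_{r^{-1}s}$ and $\alpha_{s^{-1}r}(x)=y$; $\alpha^{e}_s([t,x])=[st,x]$. The space $X$ is identified with an open subspace of $X^{e}$ via $x\mapsto[e,x]$, and $X^{e}=\bigcup_{t}\alpha^{e}_t(X)$.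 *)

theory Defs
  imports "HOL-Analysis.Analysis" "HOL-Algebra.Group"
begin

text \<open>No separation axiom is imposed on the topology of a topological group.\<close>

locale topological_group = group G for G (structure) +
  fixes T :: "'a topology"
  assumes topspace_eq_carrier: "topspace T = carrier G"
    and continuous_mult: "continuous_map (prod_topology T T) T (\<lambda>(s, t). s \<otimes> t)"
    and continuous_inv: "continuous_map T T (\<lambda>t. inv t)"

text \<open>
  A partial action is given by the family \<open>D\<close> of its ranges (\<open>D t\<close> is written \<open>X\<^sub>t\<close> on paper) and
  the family \<open>\<alpha>\<close> of its maps. HOL functions are total, so the values of \<open>\<alpha> t\<close> outside
  \<open>D (inv t)\<close> carry no meaning.
\<close>

definition partial_action_domain ::
    "('g, 'm) monoid_scheme \<Rightarrow> ('g \<Rightarrow> 'x set) \<Rightarrow> ('g \<times> 'x) set" where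
  "partial_action_domain G D = {(t, x). t \<in> carrier G \<and> x \<in> D (inv\<^bsub>G\<^esub> t)}"

text \<open>
  In the axiom \<open>extension\<close>, the first two set memberships say that \<open>x\<close> lies in the domain of the
  partial composition of \<open>\<alpha> s\<close> and \<open>\<alpha> t\<close>.
\<close>

locale partial_action = topological_group G T for G (structure) and T +
  fixes X :: "'x topology" and D :: "'a \<Rightarrow> 'x set" and \<alpha> :: "'a \<Rightarrow> 'x \<Rightarrow> 'x"
  assumes open_range: "t \<in> carrier G \<Longrightarrow> openin X (D t)"
    and homeomorphic: "t \<in> carrier G \<Longrightarrow>
          homeomorphic_map (subtopology X (D (inv t))) (subtopology X (D t)) (\<alpha> t)"
    and open_domain: "openin (prod_topology T X) (partial_action_domain G D)"
    and continuous_action: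
          "continuous_map (subtopology (prod_topology T X) (partial_action_domain G D)) X
             (\<lambda>(t, x). \<alpha> t x)"
    and range_one: "D \<one> = topspace X"
    and extension: "\<lbrakk>s \<in> carrier G; t \<in> carrier G; x \<in> D (inv t); \<alpha> t x \<in> D (inv s)\<rbrakk>
          \<Longrightarrow> x \<in> D (inv (s \<otimes> t)) \<and> \<alpha> (s \<otimes> t) x = \<alpha> s (\<alpha> t x)"

definition partial_action_graph ::
    "('g, 'm) monoid_scheme \<Rightarrow> ('g \<Rightarrow> 'x set) \<Rightarrow> ('g \<Rightarrow> 'x \<Rightarrow> 'x) \<Rightarrow> ('g \<times> 'x \<times> 'x) set" where
  "partial_action_graph G D \<alpha> =
     {(t, x, y). t \<in> carrier G \<and> x \<in> D (inv\<^bsub>G\<^esub> t) \<and> \<alpha> t x = y}"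

definition quotient_topology :: "'a topology \<Rightarrow> ('a \<times> 'a) set \<Rightarrow> 'a set topology" where
  "quotient_topology Y R =
     topology (\<lambda>U. U \<subseteq> topspace Y // R \<and> openin Y {p \<in> topspace Y. R `` {p} \<in> U})"

definition enveloping_rel ::
    "('g, 'm) monoid_scheme \<Rightarrow> 'x topology \<Rightarrow> ('g \<Rightarrow> 'x set) \<Rightarrow> ('g \<Rightarrow> 'x \<Rightarrow> 'x)
       \<Rightarrow> (('g \<times> 'x) \<times> ('g \<times> 'x)) set" where
  "enveloping_rel G X D \<alpha> =
     {((r, x), (s, y)). r \<in> carrier G \<and> s \<in> carrier G \<and> x \<in> topspace X \<and> y \<in> topspace X \<and>
        x \<in> D (inv\<^bsub>G\<^esub> r \<otimes>\<^bsub>G\<^esub> s) \<and> \<alpha> (inv\<^bsub>G\<^esub> s \<otimes>\<^bsub>G\<^esub> r) x = y}"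

definition enveloping_space ::
    "('g, 'm) monoid_scheme \<Rightarrow> 'g topology \<Rightarrow> 'x topology \<Rightarrow> ('g \<Rightarrow> 'x set) \<Rightarrow> ('g \<Rightarrow> 'x \<Rightarrow> 'x)
       \<Rightarrow> ('g \<times> 'x) set topology" where
  "enveloping_space G T X D \<alpha> =
     quotient_topology (prod_topology T X) (enveloping_rel G X D \<alpha>)"

lemma openin_quotient_topology:
  "openin (quotient_topology Y R) U \<longleftrightarrow>
     U \<subseteq> topspace Y // R \<and> openin Y {p \<in> topspace Y. R `` {p} \<in> U}"
proof -
  have "istopology (\<lambda>U. U \<subseteq> topspace Y // R \<and> openin Y {p \<in> topspace Y. R `` {p} \<in> U})"
    unfolding istopology_def
  proof (intro conjI allI impI)
    fix S V
    assume "S \<subseteq> topspace Y // R \<and> openin Y {p \<in> topspace Y. R `` {p} \<in> S}"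
      and "V \<subseteq> topspace Y // R \<and> openin Y {p \<in> topspace Y. R `` {p} \<in> V}"
    moreover have "{p \<in> topspace Y. R `` {p} \<in> S \<inter> V} =
        {p \<in> topspace Y. R `` {p} \<in> S} \<inter> {p \<in> topspace Y. R `` {p} \<in> V}" by auto
    ultimately show "S \<inter> V \<subseteq> topspace Y // R" "openin Y {p \<in> topspace Y. R `` {p} \<in> S \<inter> V}"
      by auto
  next
    fix K
    assume K: "\<forall>U\<in>K. U \<subseteq> topspace Y // R \<and> openin Y {p \<in> topspace Y. R `` {p} \<in> U}"
    then show "\<Union>K \<subseteq> topspace Y // R" by blast
    have "{p \<in> topspace Y. R `` {p} \<in> \<Union>K} = (\<Union>U\<in>K. {p \<in> topspace Y. R `` {p} \<in> U})" by auto
    then show "openin Y {p \<in> topspace Y. R `` {p} \<in> \<Union>K}" using K by auto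
  qed
  then show ?thesis by (simp add: quotient_topology_def)
qed

lemma topspace_quotient_topology: "topspace (quotient_topology Y R) = topspace Y // R"
proof -
  have "{p \<in> topspace Y. R `` {p} \<in> topspace Y // R} = topspace Y" by (auto simp: quotient_def)
  then have "openin (quotient_topology Y R) (topspace Y // R)"
    by (simp add: openin_quotient_topology)
  then show ?thesis
    by (meson openin_quotient_topology openin_subset openin_topspace subset_antisym)
qed

lemma quotient_map_quotient_topology:
  "quotient_map Y (quotient_topology Y R) (\<lambda>p. R `` {p})"
  by (auto simp: quotient_map_def topspace_quotient_topology openin_quotient_topology quotient_def)

context partial_action
begin

lemma range_subset: "t \<in> carrier G \<Longrightarrow> D t \<subseteq> topspace X"
  using open_range openin_subset by blast

lemma action_image: "t \<in> carrier G \<Longrightarrow> \<alpha> t ` D (inv t) = D t"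
  using homeomorphic_imp_surjective_map[OF homeomorphic, of t] range_subset[of t]
    range_subset[of "inv t"]
  by (simp add: Int_absorb1)

lemma action_one: assumes "x \<in> topspace X" shows "\<alpha> \<one> x = x"
proof -
  have inj: "inj_on (\<alpha> \<one>) (topspace X)"
    using homeomorphic_imp_injective_map[OF homeomorphic, of \<one>] range_one by simp
  have mem: "\<alpha> \<one> x \<in> topspace X" using action_image[of \<one>] assms range_one by auto
  then have "\<alpha> \<one> (\<alpha> \<one> x) = \<alpha> \<one> x"
    using extension[of \<one> \<one> x] assms range_one by simp
  then show ?thesis using inj mem assms by (simp add: inj_on_eq_iff)
qed

lemma equiv_enveloping_rel:
  "equiv (topspace (prod_topology T X)) (enveloping_rel G X D \<alpha>)"
proof -
  let ?R = "enveloping_rel G X D \<alpha>"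
  have inv_eq: "inv (inv a \<otimes> b) = inv b \<otimes> a" if "a \<in> carrier G" "b \<in> carrier G" for a b
    using that by (simp add: inv_mult_group)
  have sub: "?R \<subseteq> topspace (prod_topology T X) \<times> topspace (prod_topology T X)"
    by (auto simp: enveloping_rel_def topspace_eq_carrier)
  moreover have "refl_on (topspace (prod_topology T X)) ?R"
    by (auto simp: refl_on_def enveloping_rel_def topspace_eq_carrier range_one action_one)
  moreover have "sym ?R"
  proof (rule symI, clarify)
    fix r x s y
    assume "((r, x), (s, y)) \<in> ?R"
    then have c: "r \<in> carrier G" "s \<in> carrier G" "x \<in> topspace X" "y \<in> topspace X"
      and x: "x \<in> D (inv r \<otimes> s)" and y: "\<alpha> (inv s \<otimes> r) x = y"
      by (auto simp: enveloping_rel_def)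
    have "y \<in> D (inv s \<otimes> r)"
      using action_image[of "inv s \<otimes> r"] c x y inv_eq[of s r] by auto
    moreover have "(inv r \<otimes> s) \<otimes> (inv s \<otimes> r) = \<one>"
      using c by (metis inv_closed inv_eq l_inv m_closed)
    then have "\<alpha> (inv r \<otimes> s) y = x"
      using extension[of "inv r \<otimes> s" "inv s \<otimes> r" x] c x y inv_eq calculation
      by (simp add: action_one)
    ultimately show "((s, y), (r, x)) \<in> ?R" using c by (simp add: enveloping_rel_def)
  qed
  moreover have "trans ?R"
  proof (rule transI, clarify)
    fix r x s y t z
    assume "((r, x), (s, y)) \<in> ?R" "((s, y), (t, z)) \<in> ?R"
    then have c: "r \<in> carrier G" "s \<in> carrier G" "t \<in> carrier G" "x \<in> topspace X" "z \<in> topspace X"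
      and x: "x \<in> D (inv r \<otimes> s)" "\<alpha> (inv s \<otimes> r) x = y"
      and y: "y \<in> D (inv s \<otimes> t)" "\<alpha> (inv t \<otimes> s) y = z"
      by (auto simp: enveloping_rel_def)
    have "(inv t \<otimes> s) \<otimes> (inv s \<otimes> r) = inv t \<otimes> r"
      using c by (metis inv_closed inv_solve_left m_assoc m_closed)
    then show "((r, x), (t, z)) \<in> ?R"
      using extension[of "inv t \<otimes> s" "inv s \<otimes> r" x] c x y inv_eq
      by (simp add: enveloping_rel_def)
  qed
  ultimately show ?thesis by (simp add: equiv_def)
qed

end

end

theory Submission
  imports Defs
begin

text \<open>
  The quotient map \<open>q\<close> from \<open>G \<times> X\<close> onto \<open>X\<^sup>e\<close> is open, because the saturation of an open set
  is the union over \<open>t\<close> of its preimages under \<open>(s, y) \<mapsto> (s t, \<alpha>\<^bsub>inv t\<^esub> y)\<close>, each defined on an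
  open set. Hence \<open>X\<^sup>e\<close> is Hausdorff iff the enveloping relation is closed. That relation is the
  preimage of the graph under the continuous map \<open>((r, x), (s, y)) \<mapsto> (inv s r, x, y)\<close>, and
  the graph is the preimage of the relation under \<open>(t, x, y) \<mapsto> ((t, x), (e, y))\<close>.
\<close>

text \<open>The kernel is the preimage of the diagonal of \<open>Z\<close> under \<open>f\<close>
  applied in both coordinates, and the diagonal of a Hausdorff space is closed.\<close>

lemma continuous_map_imp_closedin_kernel:
  assumes f: "continuous_map Y Z f" and Z: "Hausdorff_space Z"
  shows "closedin (prod_topology Y Y) {(p, q). p \<in> topspace Y \<and> q \<in> topspace Y \<and> f p = f q}"
proof -
  have "continuous_map (prod_topology Y Y) (prod_topology Z Z) (\<lambda>u. (f (fst u), f (snd u)))"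
    using f by (intro continuous_intros continuous_map_compose[OF continuous_map_fst f, unfolded o_def]
        continuous_map_compose[OF continuous_map_snd f, unfolded o_def])
  moreover have "closedin (prod_topology Z Z) ((\<lambda>z. (z, z)) ` topspace Z)"
    using Z by (simp add: Hausdorff_space_closedin_diagonal)
  ultimately have "closedin (prod_topology Y Y)
      {u \<in> topspace (prod_topology Y Y). (f (fst u), f (snd u)) \<in> (\<lambda>z. (z, z)) ` topspace Z}"
    by (rule closedin_continuous_map_preimage)
  moreover have "{u \<in> topspace (prod_topology Y Y). (f (fst u), f (snd u)) \<in> (\<lambda>z. (z, z)) ` topspace Z}
      = {(p, q). p \<in> topspace Y \<and> q \<in> topspace Y \<and> f p = f q}"
    using continuous_map_funspace[OF f] by auto
  ultimately show ?thesis by simp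
qed

text \<open>Points of \<open>Y\<close> over distinct points of \<open>Z\<close> lie off the closed
  kernel, so some open box around the pair misses it. The images of its two sides are open, and a
  common value would put a point of the box into the kernel.\<close>

lemma Hausdorff_space_open_map_image:
  assumes f: "open_map Y Z f" "f ` topspace Y = topspace Z"
    and ker: "closedin (prod_topology Y Y) {(p, q). p \<in> topspace Y \<and> q \<in> topspace Y \<and> f p = f q}"
      (is "closedin _ ?K")
  shows "Hausdorff_space Z"
  unfolding Hausdorff_space_def
proof clarify
  fix a b assume "a \<in> topspace Z" "b \<in> topspace Z" "a \<noteq> b"
  then obtain p q where pq: "p \<in> topspace Y" "q \<in> topspace Y" "f p = a" "f q = b"
    using f(2) by (metis imageE)
  have "openin (prod_topology Y Y) (topspace Y \<times> topspace Y - ?K)"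
    using ker by (simp add: closedin_def)
  moreover have "(p, q) \<in> topspace Y \<times> topspace Y - ?K" using pq \<open>a \<noteq> b\<close> by auto
  ultimately have "\<exists>U V. openin Y U \<and> openin Y V \<and> p \<in> U \<and> q \<in> V \<and>
      U \<times> V \<subseteq> topspace Y \<times> topspace Y - ?K"
    by (simp only: openin_prod_topology_alt)
  then obtain U V where UV: "openin Y U" "openin Y V" "p \<in> U" "q \<in> V"
      "U \<times> V \<subseteq> topspace Y \<times> topspace Y - ?K"
    by (elim exE conjE)
  have "f u \<noteq> f v" if "u \<in> U" "v \<in> V" for u v
  proof -
    have "(u, v) \<in> topspace Y \<times> topspace Y - ?K" using that UV(5) by blast
    then show ?thesis by simp
  qed
  then have "disjnt (f ` U) (f ` V)"
    by (auto simp: disjnt_iff)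
  moreover have "openin Z (f ` U)" "openin Z (f ` V)"
    using f(1) UV by (auto simp: open_map_def)
  ultimately show "\<exists>U V. openin Z U \<and> openin Z V \<and> a \<in> U \<and> b \<in> V \<and> disjnt U V"
    using UV pq by blast
qed

text \<open>The condition \<open>sat\<close> says that the class map is open. The map is also
  continuous and onto and has kernel \<open>R\<close>, so the two preceding lemmas give the two
  directions.\<close>

lemma Hausdorff_space_quotient_topology_iff:
  assumes R: "equiv (topspace Y) R"
    and sat: "\<And>U. openin Y U \<Longrightarrow> openin Y (R `` U)"
  shows "Hausdorff_space (quotient_topology Y R) \<longleftrightarrow> closedin (prod_topology Y Y) R"
proof -
  let ?q = "\<lambda>p. R `` {p}"
  have q: "quotient_map Y (quotient_topology Y R) ?q"
    by (rule quotient_map_quotient_topology)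
  have ker: "{(p, q). p \<in> topspace Y \<and> q \<in> topspace Y \<and> ?q p = ?q q} = R"
    using eq_equiv_class_iff[OF R] equiv_type[OF R] by blast
  have "openin (quotient_topology Y R) (?q ` U)" if U: "openin Y U" for U
  proof -
    \<comment> \<open>By the definition of the quotient topology, openness of the image is openness
      of its preimage, which is the saturation of \<open>U\<close>.\<close>
    have "{p \<in> topspace Y. ?q p \<in> ?q ` U} = R `` U"
    proof (intro subset_antisym subsetI)
      fix p assume "p \<in> {p \<in> topspace Y. ?q p \<in> ?q ` U}"
      then obtain u where "u \<in> U" "p \<in> topspace Y" "?q u = ?q p" by auto
      then show "p \<in> R `` U" using eq_equiv_class[OF _ R] by blast
    next
      fix p assume "p \<in> R `` U"
      then obtain u where u: "u \<in> U" "(u, p) \<in> R" by blast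
      then have "?q u = ?q p" using equiv_class_eq[OF R] by simp
      then show "p \<in> {p \<in> topspace Y. ?q p \<in> ?q ` U}"
        using u equiv_type[OF R] by auto
    qed
    then show ?thesis
      using sat[OF U] openin_subset[OF U] by (auto simp: openin_quotient_topology quotient_def)
  qed
  then have "open_map Y (quotient_topology Y R) ?q" by (simp add: open_map_def)
  then show ?thesis
    using Hausdorff_space_open_map_image[of Y _ ?q] quotient_imp_surjective_map[OF q]
      continuous_map_imp_closedin_kernel[OF quotient_imp_continuous_map[OF q]] ker by auto
qed

context partial_action
begin

text \<open>The two domain conditions agree because
  \<open>inv (inv s \<otimes> r) = inv r \<otimes> s\<close>.\<close>

lemma enveloping_rel_iff_graph:
  assumes "r \<in> carrier G" "s \<in> carrier G" "x \<in> topspace X" "y \<in> topspace X"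
  shows "((r, x), (s, y)) \<in> enveloping_rel G X D \<alpha> \<longleftrightarrow>
         (inv s \<otimes> r, x, y) \<in> partial_action_graph G D \<alpha>"
  using assms by (simp add: enveloping_rel_def partial_action_graph_def inv_mult_group)

lemma graph_subset:
  "partial_action_graph G D \<alpha> \<subseteq> carrier G \<times> topspace X \<times> topspace X"
proof (intro subrelI, unfold split_paired_all)
  fix t x y assume "(t, x, y) \<in> partial_action_graph G D \<alpha>"
  then have t: "t \<in> carrier G" and x: "x \<in> D (inv t)" "\<alpha> t x = y"
    by (auto simp: partial_action_graph_def)
  have "y \<in> D t" using action_image[OF t] x by blast
  then show "(t, x, y) \<in> carrier G \<times> topspace X \<times> topspace X"
    using t x(1) range_subset[OF t] range_subset[OF inv_closed[OF t]] by blast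
qed

lemma continuous_action_map:
  assumes t: "t \<in> carrier G"
  shows "continuous_map (subtopology X (D (inv t))) X (\<alpha> t)"
  using homeomorphic_imp_continuous_map[OF homeomorphic[OF t]]
  by (simp add: continuous_map_in_subtopology)

lemma continuous_right_translation:
  assumes t: "t \<in> carrier G"
  shows "continuous_map T T (\<lambda>s. s \<otimes> t)"
proof -
  have "continuous_map T (prod_topology T T) (\<lambda>s. (s, t))"
    using t by (intro continuous_intros) (simp_all add: topspace_eq_carrier)
  from continuous_map_compose[OF this continuous_mult] show ?thesis by (simp add: o_def)
qed

text \<open>Pairs related to a point of \<open>U\<close> are sorted by the group element
  \<open>t = inv s \<otimes> r\<close>, which recovers the point of \<open>U\<close> as
  \<open>r = s \<otimes> t\<close> and \<open>x = \<alpha> (inv t) y\<close>.\<close>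

lemma enveloping_rel_Image:
  assumes U: "U \<subseteq> carrier G \<times> topspace X"
  shows "enveloping_rel G X D \<alpha> `` U =
    (\<Union>t\<in>carrier G. {(s, y) \<in> carrier G \<times> D t. (s \<otimes> t, \<alpha> (inv t) y) \<in> U})"
    (is "?L = ?R")
proof (intro subset_antisym subsetI)
  fix v assume "v \<in> ?L"
  then obtain r x s y where v: "v = (s, y)" and rx: "(r, x) \<in> U"
    and rel: "((r, x), (s, y)) \<in> enveloping_rel G X D \<alpha>"
    by (metis ImageE surj_pair)
  have c: "r \<in> carrier G" "s \<in> carrier G" using rel by (auto simp: enveloping_rel_def)
  \<comment> \<open>The relation expresses \<open>y\<close> through \<open>x\<close>; symmetry is
    used to express \<open>x\<close> through \<open>y\<close>.\<close>
  have "((s, y), (r, x)) \<in> enveloping_rel G X D \<alpha>"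
    using rel equiv_enveloping_rel by (meson equivE symE)
  then have "y \<in> D (inv s \<otimes> r)" "\<alpha> (inv (inv s \<otimes> r)) y = x"
    using c by (auto simp: enveloping_rel_def inv_mult_group)
  moreover have "s \<otimes> (inv s \<otimes> r) = r"
    using c by (simp add: m_assoc[symmetric])
  ultimately show "v \<in> ?R"
    using v rx c by (auto intro!: bexI[of _ "inv s \<otimes> r"])
next
  fix v assume "v \<in> ?R"
  then obtain t s y where v: "v = (s, y)" and c: "t \<in> carrier G" "s \<in> carrier G"
    and y: "y \<in> D t" and u: "(s \<otimes> t, \<alpha> (inv t) y) \<in> U" by auto
  have "inv (s \<otimes> t) \<otimes> s = inv t" "inv s \<otimes> (s \<otimes> t) = t"
    using c by (simp_all add: inv_mult_group m_assoc m_assoc[symmetric, of "inv s" s])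
  \<comment> \<open>That \<open>\<alpha> (inv t) y\<close> is a point of \<open>X\<close> follows
    from \<open>u\<close> and the assumption on \<open>U\<close>.\<close>
  then have "((s, y), (s \<otimes> t, \<alpha> (inv t) y)) \<in> enveloping_rel G X D \<alpha>"
    using c y u U range_subset by (auto simp: enveloping_rel_def)
  then have "((s \<otimes> t, \<alpha> (inv t) y), (s, y)) \<in> enveloping_rel G X D \<alpha>"
    using equiv_enveloping_rel by (meson equivE symE)
  then show "v \<in> ?L" using u v by blast
qed

lemma openin_enveloping_rel_Image:
  assumes U: "openin (prod_topology T X) U"
  shows "openin (prod_topology T X) (enveloping_rel G X D \<alpha> `` U)"
proof -
  have "openin (prod_topology T X) {(s, y) \<in> carrier G \<times> D t. (s \<otimes> t, \<alpha> (inv t) y) \<in> U}"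
    if t: "t \<in> carrier G" for t
  proof -
    have "continuous_map (prod_topology T (subtopology X (D t))) (prod_topology T X)
        (\<lambda>v. (fst v \<otimes> t, \<alpha> (inv t) (snd v)))"
      \<comment> \<open>The map \<open>\<alpha> (inv t)\<close> has domain
        \<open>D (inv (inv t))\<close>, which is \<open>D t\<close>.\<close>
      using continuous_map_compose[OF continuous_map_fst continuous_right_translation[OF t]]
        continuous_map_compose[OF continuous_map_snd continuous_action_map[of "inv t"]] t
      by (intro continuous_intros) (simp_all add: o_def)
    from openin_continuous_map_preimage[OF this U]
    have "openin (subtopology (prod_topology T X) (carrier G \<times> D t))
        {v \<in> carrier G \<times> D t. (fst v \<otimes> t, \<alpha> (inv t) (snd v)) \<in> U}"
      using range_subset[OF t]
      by (simp add: topspace_eq_carrier Int_absorb1 subtopology_Times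
          flip: topspace_eq_carrier)
    \<comment> \<open>So far the piece is open only relative to
      \<open>carrier G \<times> D t\<close>; since \<open>D t\<close> is open in \<open>X\<close>,
      it is open in the whole product.\<close>
    moreover have "openin (prod_topology T X) (carrier G \<times> D t)"
      using open_range[OF t] by (simp add: openin_prod_Times_iff flip: topspace_eq_carrier)
    ultimately have "openin (prod_topology T X)
        {v \<in> carrier G \<times> D t. (fst v \<otimes> t, \<alpha> (inv t) (snd v)) \<in> U}"
      by (rule openin_trans_full)
    then show ?thesis by (simp add: case_prod_unfold mem_Times_iff conj_assoc)
  qed
  moreover have "U \<subseteq> carrier G \<times> topspace X"
    using openin_subset[OF U] by (simp add: topspace_eq_carrier)
  ultimately show ?thesis by (auto simp: enveloping_rel_Image)
qed

lemma closedin_enveloping_rel_iff: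
  "closedin (prod_topology (prod_topology T X) (prod_topology T X)) (enveloping_rel G X D \<alpha>) \<longleftrightarrow>
   closedin (prod_topology T (prod_topology X X)) (partial_action_graph G D \<alpha>)"
  (is "closedin ?YY ?E \<longleftrightarrow> closedin ?GXX ?Gr")
proof
  \<comment> \<open>With \<open>\<one>\<close> as second group element,
    \<open>inv \<one> \<otimes> t = t\<close>, so the relation between these two points is exactly
    membership of \<open>(t, x, y)\<close> in the graph.\<close>
  let ?g = "\<lambda>(t, x, y). ((t, x), (\<one>, y))"
  have "continuous_map ?GXX ?YY ?g"
    unfolding case_prod_unfold
    by (intro continuous_intros continuous_map_compose[OF continuous_map_snd continuous_map_fst, unfolded o_def]
        continuous_map_compose[OF continuous_map_snd continuous_map_snd, unfolded o_def])
      (simp add: topspace_eq_carrier)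
  moreover assume "closedin ?YY ?E"
  ultimately have "closedin ?GXX {v \<in> topspace ?GXX. ?g v \<in> ?E}"
    by (rule closedin_continuous_map_preimage)
  \<comment> \<open>The preimage is cut down to the product space; \<open>graph_subset\<close>
    ensures that no point of the graph is lost.\<close>
  moreover have "{v \<in> topspace ?GXX. ?g v \<in> ?E} = ?Gr"
    using graph_subset by (auto simp: topspace_eq_carrier enveloping_rel_iff_graph)
  ultimately show "closedin ?GXX ?Gr" by simp
next
  let ?h = "\<lambda>((r, x), (s, y)). (inv s \<otimes> r, x, y)"
  have fst_snd: "continuous_map ?YY T (\<lambda>v. fst (fst v))" "continuous_map ?YY X (\<lambda>v. snd (fst v))"
    "continuous_map ?YY T (\<lambda>v. fst (snd v))" "continuous_map ?YY X (\<lambda>v. snd (snd v))"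
    by (metis (no_types) continuous_map_compose[unfolded o_def] continuous_map_fst continuous_map_snd)+
  \<comment> \<open>The first coordinate of \<open>?h\<close> is multiplication applied to the pair
    \<open>(inv s, r)\<close>.\<close>
  have "continuous_map ?YY (prod_topology T T) (\<lambda>v. (inv fst (snd v), fst (fst v)))"
    using fst_snd continuous_map_compose[OF fst_snd(3) continuous_inv, unfolded o_def]
    by (intro continuous_intros)
  from continuous_map_compose[OF this continuous_mult]
  have "continuous_map ?YY T (\<lambda>v. inv fst (snd v) \<otimes> fst (fst v))"
    by (simp add: o_def)
  then have "continuous_map ?YY ?GXX ?h"
    unfolding case_prod_unfold by (intro continuous_intros fst_snd)
  moreover assume "closedin ?GXX ?Gr"
  ultimately have "closedin ?YY {v \<in> topspace ?YY. ?h v \<in> ?Gr}"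
    by (rule closedin_continuous_map_preimage)
  moreover have "{v \<in> topspace ?YY. ?h v \<in> ?Gr} = ?E"
    using equiv_type[OF equiv_enveloping_rel]
    by (auto simp: topspace_eq_carrier enveloping_rel_iff_graph)
  ultimately show "closedin ?YY ?E" by simp
qed

end

theorem proposition2p10:
  fixes G :: "('g, 'm) monoid_scheme"
    and T :: "'g topology"
    and X :: "'x topology"
    and D :: "'g \<Rightarrow> 'x set"
    and \<alpha> :: "'g \<Rightarrow> 'x \<Rightarrow> 'x"
  assumes "partial_action G T X D \<alpha>"
    and "Hausdorff_space X"
  shows "Hausdorff_space (enveloping_space G T X D \<alpha>) \<longleftrightarrow>
         closedin (prod_topology T (prod_topology X X)) (partial_action_graph G D \<alpha>)"
proof -
  interpret partial_action G T X D \<alpha> by fact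
  show ?thesis
    unfolding enveloping_space_def closedin_enveloping_rel_iff[symmetric]
    using equiv_enveloping_rel openin_enveloping_rel_Image
    by (rule Hausdorff_space_quotient_topology_iff)
qed

end
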